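(* Let $S$ be a topological semigroup with open shifts. Then $S_{sr}$ (with the same semigroup operation) is a topological semigroup. Moreover, if $S$ is a monoid, then $S$ is quasiregular, i.e. $S_{sr}$ is a $T_3$ space.
   Context: A topological semigroup is a nonempty semigroup $S$ with a topology (no separation axiom assumed) for which the operation $S\times S\to S$ is continuous. It has open shifts if for every $a\in S$ and every open $U\subseteq S$ the sets $aU$ and $Ua$ are open in $S$. For a topological space $X$, an open set $U$ is regular open if $\mathrm{Int}(\overline{U})=U$; the regular open sets form a base of a topology on the set $X$, and $X_{sr}$ (the semiregularization) denotes $X$ with this topology. A space is $T_3$ if every point and every closed set not containing it have disjoint open neighborhoods ($T_1$ is not assumed). $X$ is quasiregular if $X_{sr}$ is $T_3$. *)

theory Defs
  imports "HOL-Analysis.Analysis"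
begin

definition regular_openin :: "'a topology \<Rightarrow> 'a set \<Rightarrow> bool" where
  "regular_openin X U \<longleftrightarrow> openin X U \<and> X interior_of (X closure_of U) = U"

definition semiregularization :: "'a topology \<Rightarrow> 'a topology" where
  "semiregularization X = topology (arbitrary union_of (regular_openin X))"

lemma regular_openin_Int:
  assumes "regular_openin X U" and "regular_openin X V"
  shows "regular_openin X (U \<inter> V)"
proof -
  have o: "openin X (U \<inter> V)"
    using assms by (auto simp: regular_openin_def)
  have "X closure_of (U \<inter> V) \<subseteq> X closure_of U \<inter> X closure_of V"
    by (simp add: closure_of_mono)
  then have "X interior_of (X closure_of (U \<inter> V)) \<subseteq> U \<inter> V"
    using assms unfolding regular_openin_def by (metis interior_of_Int interior_of_mono)
  moreover have "U \<inter> V \<subseteq> X interior_of (X closure_of (U \<inter> V))"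
    using o by (simp add: closure_of_subset interior_of_maximal openin_subset)
  ultimately show ?thesis
    using o by (auto simp: regular_openin_def)
qed

text \<open>The regular open sets form a base, so the topology above is the intended one
  (and not an unspecified value of \<^const>\<open>topology\<close>).\<close>

lemma openin_semiregularization:
  "openin (semiregularization X) = arbitrary union_of (regular_openin X)"
  unfolding semiregularization_def
  by (metis topology_inverse' istopology_base regular_openin_Int)

lemma topspace_semiregularization [simp]: "topspace (semiregularization X) = topspace X"
proof
  show "topspace (semiregularization X) \<subseteq> topspace X"
  proof
    fix x assume "x \<in> topspace (semiregularization X)"
    then obtain U where "openin (semiregularization X) U" "x \<in> U"
      by (auto simp: topspace_def)
    then obtain V where "regular_openin X V" "x \<in> V"
      by (auto simp: openin_semiregularization union_of_def)
    then show "x \<in> topspace X"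
      by (meson openin_subset regular_openin_def subsetD)
  qed
next
  have "regular_openin X (topspace X)"
    by (simp add: regular_openin_def)
  then have "openin (semiregularization X) (topspace X)"
    by (simp add: openin_semiregularization arbitrary_union_of_inc)
  then show "topspace X \<subseteq> topspace (semiregularization X)"
    by (rule openin_subset)
qed

text \<open>\<^const>\<open>regular_space\<close> is the axiom $T_3$ without $T_1$.\<close>

definition quasiregular_space :: "'a topology \<Rightarrow> bool" where
  "quasiregular_space X \<longleftrightarrow> regular_space (semiregularization X)"

definition semigroup_on :: "'a set \<Rightarrow> ('a \<Rightarrow> 'a \<Rightarrow> 'a) \<Rightarrow> bool" where
  "semigroup_on S f \<longleftrightarrow>
     (\<forall>x\<in>S. \<forall>y\<in>S. f x y \<in> S) \<and>
     (\<forall>x\<in>S. \<forall>y\<in>S. \<forall>z\<in>S. f (f x y) z = f x (f y z))"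

definition monoid_on :: "'a set \<Rightarrow> ('a \<Rightarrow> 'a \<Rightarrow> 'a) \<Rightarrow> bool" where
  "monoid_on S f \<longleftrightarrow> semigroup_on S f \<and> (\<exists>e\<in>S. \<forall>x\<in>S. f e x = x \<and> f x e = x)"

definition topological_semigroup :: "'a topology \<Rightarrow> ('a \<Rightarrow> 'a \<Rightarrow> 'a) \<Rightarrow> bool" where
  "topological_semigroup X f \<longleftrightarrow>
     topspace X \<noteq> {} \<and> semigroup_on (topspace X) f \<and>
     continuous_map (prod_topology X X) X (\<lambda>(x, y). f x y)"

definition open_shifts :: "'a topology \<Rightarrow> ('a \<Rightarrow> 'a \<Rightarrow> 'a) \<Rightarrow> bool" where
  "open_shifts X f \<longleftrightarrow>
     (\<forall>a\<in>topspace X. \<forall>U. openin X U \<longrightarrow>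
        openin X ((\<lambda>x. f a x) ` U) \<and> openin X ((\<lambda>x. f x a) ` U))"

end

theory Submission
  imports Defs
begin

text \<open>Continuity gives \<open>cl U \<cdot> cl V \<subseteq> cl (U V)\<close>, and open shifts make \<open>A V\<close> open for every set
  \<open>A\<close> and every open \<open>V\<close>. So if \<open>U V\<close> lies in a regular open set \<open>W\<close>, then \<open>A V' \<subseteq> W\<close> for
  every \<open>A \<subseteq> cl U\<close> and every open \<open>V' \<subseteq> cl V\<close>. Taking \<open>A = int (cl U)\<close> and \<open>V' = int (cl V)\<close>
  gives continuity of the operation for the semiregularization. In a monoid, taking \<open>A = cl U\<close>
  and for \<open>V' = V\<close> a neighbourhood of the identity gives \<open>cl U \<subseteq> cl U \<cdot> V \<subseteq> W\<close>, and \<open>cl U\<close> is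
  closed in the semiregularization.\<close>

lemma regular_openin_interior_closure_of:
  "regular_openin X (X interior_of (X closure_of U))"
  unfolding regular_openin_def
proof (intro conjI subset_antisym)
  let ?U = "X interior_of (X closure_of U)"
  show "openin X ?U" by simp
  have "X closure_of ?U \<subseteq> X closure_of U"
    by (simp add: closure_of_minimal interior_of_subset)
  then show "X interior_of (X closure_of ?U) \<subseteq> ?U"
    by (rule interior_of_mono)
  show "?U \<subseteq> X interior_of (X closure_of ?U)"
    by (simp add: closure_of_subset interior_of_maximal interior_of_subset_topspace)
qed

lemma subset_interior_closure_of:
  "openin X U \<Longrightarrow> U \<subseteq> X interior_of (X closure_of U)"
  by (simp add: closure_of_subset interior_of_maximal openin_subset)

lemma regular_openin_imp_openin_semiregularization:
  "regular_openin X U \<Longrightarrow> openin (semiregularization X) U"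
  by (simp add: openin_semiregularization arbitrary_union_of_inc)

lemma openin_semiregularizationE:
  assumes "openin (semiregularization X) W" "x \<in> W"
  obtains V where "regular_openin X V" "x \<in> V" "V \<subseteq> W"
  using assms by (auto simp: openin_semiregularization union_of_def)

text \<open>The complement of \<open>X closure_of U\<close> is the interior of the closed set
  \<open>topspace X - U\<close>. A closed set equals its closure, so this complement is the interior
  of a closure and hence regular open.\<close>

lemma closedin_semiregularization_closure_of:
  assumes "openin X U"
  shows "closedin (semiregularization X) (X closure_of U)"
proof -
  have "closedin X (topspace X - U)"
    using assms by blast
  then have "topspace X - X closure_of U = X interior_of (X closure_of (topspace X - U))"
    by (simp add: interior_of_complement closure_of_closedin)
  then show ?thesis
    using regular_openin_interior_closure_of[of X "topspace X - U"]
    by (simp add: closedin_def closure_of_subset_topspace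
        regular_openin_imp_openin_semiregularization)
qed

text \<open>The product is the union of the left shifts of \<open>V\<close> by the elements of
  \<open>A\<close>, so openness comes from \<open>V\<close> alone; this permits a closure as
  \<open>A\<close>.\<close>

lemma open_shifts_openin_image_Times:
  assumes "open_shifts X f" "A \<subseteq> topspace X" "openin X V"
  shows "openin X ((\<lambda>(x, y). f x y) ` (A \<times> V))"
proof -
  have "(\<lambda>(x, y). f x y) ` (A \<times> V) = (\<Union>a\<in>A. f a ` V)"
    by auto
  moreover have "openin X (f a ` V)" if "a \<in> A" for a
    using assms that by (auto simp: open_shifts_def)
  ultimately show ?thesis
    by auto
qed

lemma continuous_map_prod_nbhds:
  assumes "continuous_map (prod_topology X Y) Z (\<lambda>(x, y). f x y)"
    and "openin Z W" "x \<in> topspace X" "y \<in> topspace Y" "f x y \<in> W"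
  obtains U V where "openin X U" "openin Y V" "x \<in> U" "y \<in> V"
    "(\<lambda>(x, y). f x y) ` (U \<times> V) \<subseteq> W"
proof -
  let ?P = "{p \<in> topspace (prod_topology X Y). (\<lambda>(x, y). f x y) p \<in> W}"
  have "openin (prod_topology X Y) ?P"
    using assms(1,2) by (rule openin_continuous_map_preimage)
  moreover have "(x, y) \<in> ?P"
    using assms by simp
  ultimately obtain U V where UV: "openin X U" "openin Y V" "x \<in> U" "y \<in> V" "U \<times> V \<subseteq> ?P"
    unfolding openin_prod_topology_alt by meson
  from UV(5) have "(\<lambda>(x, y). f x y) ` (U \<times> V) \<subseteq> W"
    by auto
  with UV(1-4) show thesis
    by (rule that)
qed

lemma image_Times_subset_regular_openin:
  assumes cont: "continuous_map (prod_topology X X) X (\<lambda>(x, y). f x y)"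
    and shifts: "open_shifts X f" and W: "regular_openin X W"
    and UV: "(\<lambda>(x, y). f x y) ` (U \<times> V) \<subseteq> W"
    and A: "A \<subseteq> X closure_of U" and V': "openin X V'" "V' \<subseteq> X closure_of V"
  shows "(\<lambda>(x, y). f x y) ` (A \<times> V') \<subseteq> W"
proof -
  \<comment> \<open>The closure of a product set is the product of the closures, so continuity
    carries the image into the closure of \<open>W\<close>.\<close>
  have "(\<lambda>(x, y). f x y) ` (A \<times> V') \<subseteq> (\<lambda>(x, y). f x y) ` (prod_topology X X closure_of (U \<times> V))"
    using A V'(2) by (intro image_mono) (auto simp: closure_of_Times)
  also have "\<dots> \<subseteq> X closure_of ((\<lambda>(x, y). f x y) ` (U \<times> V))"
    using cont by (rule continuous_map_image_closure_subset)
  also have "\<dots> \<subseteq> X closure_of W"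
    using UV by (rule closure_of_mono)
  \<comment> \<open>The image is open by the shifts, hence lies in the interior of that closure,
    which is \<open>W\<close> by regular openness.\<close>
  finally have "(\<lambda>(x, y). f x y) ` (A \<times> V') \<subseteq> X interior_of (X closure_of W)"
    using A V' shifts closure_of_subset_topspace[of X U]
    by (intro interior_of_maximal open_shifts_openin_image_Times) auto
  then show ?thesis
    using W by (simp add: regular_openin_def)
qed

lemma continuous_map_semiregularization:
  assumes cont: "continuous_map (prod_topology X X) X (\<lambda>(x, y). f x y)"
    and shifts: "open_shifts X f"
  shows "continuous_map (prod_topology (semiregularization X) (semiregularization X))
           (semiregularization X) (\<lambda>(x, y). f x y)"
  unfolding continuous_map_def
proof (intro conjI allI impI)
  let ?R = "semiregularization X"
  let ?m = "\<lambda>(x, y). f x y"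
  show "?m \<in> topspace (prod_topology ?R ?R) \<rightarrow> topspace ?R"
    using cont by (simp add: continuous_map_def)
  fix W assume W: "openin ?R W"
  show "openin (prod_topology ?R ?R) {p \<in> topspace (prod_topology ?R ?R). ?m p \<in> W}"
    unfolding openin_prod_topology_alt
  proof (intro allI impI)
    fix x y
    assume "(x, y) \<in> {p \<in> topspace (prod_topology ?R ?R). ?m p \<in> W}"
    then have xy: "x \<in> topspace X" "y \<in> topspace X" "f x y \<in> W"
      by auto
    obtain W' where W': "regular_openin X W'" "f x y \<in> W'" "W' \<subseteq> W"
      using W xy(3) by (rule openin_semiregularizationE)
    then have "openin X W'"
      by (simp add: regular_openin_def)
    obtain U V where UV: "openin X U" "openin X V" "x \<in> U" "y \<in> V" "?m ` (U \<times> V) \<subseteq> W'"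
      using cont \<open>openin X W'\<close> xy(1,2) W'(2) by (rule continuous_map_prod_nbhds)
    \<comment> \<open>\<open>U\<close> and \<open>V\<close> come from continuity in the original
      topology and may fail to be open in \<open>?R\<close>. Their enlargements are open there and
      still multiply into \<open>W'\<close>.\<close>
    let ?U = "X interior_of (X closure_of U)"
    let ?V = "X interior_of (X closure_of V)"
    have "?m ` (?U \<times> ?V) \<subseteq> W'"
      using cont shifts W'(1) UV(5)
      by (rule image_Times_subset_regular_openin) (auto simp: interior_of_subset)
    then have "?U \<times> ?V \<subseteq> {p \<in> topspace (prod_topology ?R ?R). ?m p \<in> W}"
      using W'(3) interior_of_subset_topspace[of X "X closure_of U"]
        interior_of_subset_topspace[of X "X closure_of V"] by auto
    moreover have "x \<in> ?U" "y \<in> ?V"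
      using UV subset_interior_closure_of by blast+
    moreover have "openin ?R ?U" "openin ?R ?V"
      by (rule regular_openin_imp_openin_semiregularization[OF regular_openin_interior_closure_of])+
    ultimately show "\<exists>U V. openin ?R U \<and> openin ?R V \<and> x \<in> U \<and> y \<in> V \<and>
        U \<times> V \<subseteq> {p \<in> topspace (prod_topology ?R ?R). ?m p \<in> W}"
      by blast
  qed
qed

lemma quasiregular_space_monoid:
  assumes cont: "continuous_map (prod_topology X X) X (\<lambda>(x, y). f x y)"
    and shifts: "open_shifts X f"
    and e: "e \<in> topspace X" "\<And>x. x \<in> topspace X \<Longrightarrow> f x e = x"
  shows "quasiregular_space X"
  \<comment> \<open>Regularity is equivalent to every point having a base of closed neighbourhoods,
    and that form is proved.\<close>
  unfolding quasiregular_space_def neighbourhood_base_of_closedin[symmetric] neighbourhood_base_of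
proof (intro allI impI, elim conjE)
  let ?R = "semiregularization X"
  let ?m = "\<lambda>(x, y). f x y"
  fix W x assume W: "openin ?R W" "x \<in> W"
  then have x: "x \<in> topspace X"
    using openin_subset by fastforce
  obtain W' where W': "regular_openin X W'" "x \<in> W'" "W' \<subseteq> W"
    using W by (rule openin_semiregularizationE)
  \<comment> \<open>Since \<open>f x e = x\<close>, continuity can be applied at the pair
    \<open>(x, e)\<close>.\<close>
  have "openin X W'" "f x e \<in> W'"
    using W' x e by (auto simp: regular_openin_def)
  then obtain U V where UV: "openin X U" "openin X V" "x \<in> U" "e \<in> V" "?m ` (U \<times> V) \<subseteq> W'"
    using cont x e(1) by (elim continuous_map_prod_nbhds)
  \<comment> \<open>The left factor is the whole closure, so that the neighbourhood obtained is
    closed in \<open>?R\<close>.\<close>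
  have "?m ` ((X closure_of U) \<times> V) \<subseteq> W'"
    using cont shifts W'(1) UV(5) order_refl UV(2)
    by (rule image_Times_subset_regular_openin) (rule closure_of_subset[OF openin_subset[OF UV(2)]])
  \<comment> \<open>Because \<open>e\<close> lies in \<open>V\<close>, \<open>z = f z e\<close>
    exhibits each point of the closure as a product.\<close>
  moreover have "z \<in> ?m ` ((X closure_of U) \<times> V)" if "z \<in> X closure_of U" for z
  proof
    show "z = ?m (z, e)"
      using that e(2)[of z] by (simp add: in_closure_of)
  qed (use that UV(4) in simp)
  ultimately have "X closure_of U \<subseteq> W"
    using W'(3) by blast
  moreover have "x \<in> X interior_of (X closure_of U)"
    using UV subset_interior_closure_of by blast
  moreover have "openin ?R (X interior_of (X closure_of U))"
    by (rule regular_openin_imp_openin_semiregularization[OF regular_openin_interior_closure_of])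
  moreover have "closedin ?R (X closure_of U)"
    using UV(1) by (rule closedin_semiregularization_closure_of)
  ultimately show "\<exists>U V. openin ?R U \<and> closedin ?R V \<and> x \<in> U \<and> U \<subseteq> V \<and> V \<subseteq> W"
    using interior_of_subset[of X "X closure_of U"] by blast
qed

theorem theorem2p6:
  fixes S :: "'a topology" and f :: "'a \<Rightarrow> 'a \<Rightarrow> 'a"
  assumes "topological_semigroup S f" and "open_shifts S f"
  shows "topological_semigroup (semiregularization S) f \<and>
         (monoid_on (topspace S) f \<longrightarrow> quasiregular_space S)"
proof (intro conjI impI)
  have cont: "continuous_map (prod_topology S S) S (\<lambda>(x, y). f x y)"
    using assms(1) by (simp add: topological_semigroup_def)
  \<comment> \<open>The underlying set is unchanged, so nonemptiness and the semigroup laws carry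
    over and continuity remains.\<close>
  show "topological_semigroup (semiregularization S) f"
    using assms continuous_map_semiregularization[OF cont assms(2)]
    by (simp add: topological_semigroup_def)
  assume "monoid_on (topspace S) f"
  then show "quasiregular_space S"
    using quasiregular_space_monoid[OF cont assms(2)] by (auto simp: monoid_on_def)
qed

end
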